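(* Let $r(x)=\sum_{n\ge 0}x^{2^n-1}$ and $g_n=H_n\!\left(\frac{1-r(x)}{x}\right)$ for $n\ge0$. Then the sequence $(g_n)_{n\ge 0}$ is $2$-automatic.
   Context: For a power series $f(x)=\sum_{i\ge 0}a_ix^i$ and $n\ge 1$, $H_n(f)=\det(a_{i+j})_{0\le i,j\le n-1}$, $H_0(f)=1$. A sequence $(x_n)_{n\ge0}$ is $2$-automatic if its $2$-kernel $\{(x_{2^in+j})_{n\ge 0} : i\ge 0,\ 0\le j\le 2^i-1\}$ is finite. *)

theory Defs
  imports
    "Jordan_Normal_Form.Determinant"
    "HOL-Computational_Algebra.Formal_Power_Series"
begin

definition hankel_det :: "'a::comm_ring_1 fps \<Rightarrow> nat \<Rightarrow> 'a" where
  "hankel_det f n = det (mat n n (\<lambda>(i, j). fps_nth f (i + j)))"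

lemma hankel_det_0 [simp]: "hankel_det f 0 = 1"
  by (simp add: hankel_det_def)

definition kernel_seq :: "nat \<Rightarrow> (nat \<Rightarrow> 'a) \<Rightarrow> (nat \<Rightarrow> 'a) set" where
  "kernel_seq k x = {(\<lambda>n. x (k ^ i * n + j)) | i j. j < k ^ i}"

definition automatic_seq :: "nat \<Rightarrow> (nat \<Rightarrow> 'a) \<Rightarrow> bool" where
  "automatic_seq k x \<longleftrightarrow> finite (kernel_seq k x)"

(* The infinite sum is taken in the X-adic topology on formal power series.
   Rational coefficients make division by X available; the values of the
   Hankel determinants considered are still the integer ones. *)
definition r_fps :: "rat fps" where
  "r_fps = (\<Sum>n. fps_X ^ (2 ^ n - 1))"

lemma nth_sum_X_powers:
  "fps_nth (\<Sum>n<m. fps_X ^ (2 ^ n - 1) :: rat fps) k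
     = (if \<exists>n<m. k = 2 ^ n - 1 then 1 else 0)"
proof (induction m)
  case (Suc m)
  have "(2::nat) ^ n - 1 \<noteq> 2 ^ m - 1" if "n < m" for n
  proof -
    have "(2::nat) ^ n < 2 ^ m" "(2::nat) ^ n \<ge> 1" using that by auto
    thus ?thesis by linarith
  qed
  hence disj: "\<not> (\<exists>n<m. k = 2 ^ n - 1)" if "k = 2 ^ m - 1"
    using that by metis
  have ex: "(\<exists>n<Suc m. k = 2 ^ n - 1) \<longleftrightarrow> (\<exists>n<m. k = 2 ^ n - 1) \<or> k = 2 ^ m - 1"
    using less_Suc_eq by metis
  have ifs: "(if A then 1 else 0) + (if B then 1 else 0) = (if A \<or> B then 1 else (0::rat))"
    if "B \<Longrightarrow> \<not> A" for A B
    using that by auto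
  have "fps_nth (\<Sum>n<Suc m. fps_X ^ (2 ^ n - 1) :: rat fps) k
          = (if \<exists>n<m. k = 2 ^ n - 1 then 1 else 0) + (if k = 2 ^ m - 1 then 1 else 0)"
    by (simp only: sum.lessThan_Suc fps_add_nth Suc.IH fps_X_power_nth)
  also have "\<dots> = (if (\<exists>n<m. k = 2 ^ n - 1) \<or> k = 2 ^ m - 1 then 1 else 0)"
    by (rule ifs) (rule disj)
  finally show ?case
    unfolding ex .
qed simp

lemma X_powers_sums:
  "(\<lambda>n. fps_X ^ (2 ^ n - 1) :: rat fps) sums
     Abs_fps (\<lambda>k. if \<exists>n. k = 2 ^ n - 1 then 1 else 0)"
  unfolding sums_def
proof (rule tendsto_fpsI)
  fix k :: nat
  have "n < m" if "m > k" "k = 2 ^ n - 1" for n m :: nat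
  proof -
    have "n < 2 ^ n" by (rule less_exp)
    thus ?thesis using that by linarith
  qed
  hence "fps_nth (\<Sum>n<m. fps_X ^ (2 ^ n - 1) :: rat fps) k
           = fps_nth (Abs_fps (\<lambda>k. if \<exists>n. k = 2 ^ n - 1 then 1 else 0)) k"
    if "m > k" for m
  proof -
    have "(\<exists>n<m. k = 2 ^ n - 1) \<longleftrightarrow> (\<exists>n. k = 2 ^ n - 1)"
      using that \<open>\<And>n m. k < m \<Longrightarrow> k = 2 ^ n - 1 \<Longrightarrow> n < m\<close> by blast
    thus ?thesis by (simp only: nth_sum_X_powers fps_nth_Abs_fps)
  qed
  thus "\<forall>\<^sub>F m in sequentially. fps_nth (\<Sum>n<m. fps_X ^ (2 ^ n - 1) :: rat fps) k
           = fps_nth (Abs_fps (\<lambda>k. if \<exists>n. k = 2 ^ n - 1 then 1 else 0)) k"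
    by (intro eventually_mono[OF eventually_gt_at_top[of k]])
qed

lemma r_fps_sums: "(\<lambda>n. fps_X ^ (2 ^ n - 1)) sums r_fps"
  unfolding r_fps_def using X_powers_sums by (blast intro: summable_sums sums_summable)

lemma nth_r_fps: "fps_nth r_fps k = (if \<exists>n. k = 2 ^ n - 1 then 1 else 0)"
  unfolding r_fps_def sums_unique[OF X_powers_sums, symmetric] by (rule fps_nth_Abs_fps)

(* The numerator has zero constant coefficient, so the division by X is exact. *)
definition g_seq :: "nat \<Rightarrow> rat" where
  "g_seq n = hankel_det ((1 - r_fps) / fps_X) n"

lemma one_minus_r_div_X: "(1 - r_fps) / fps_X * fps_X = 1 - r_fps"
proof -
  have "fps_nth r_fps 0 = 1"
    unfolding nth_r_fps by (auto intro: exI[of _ 0])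
  thus ?thesis
    by (intro fps_ext) (simp add: fps_X_mult_right_nth)
qed

end

theory Submission
  imports Defs
begin

text \<open>
  The Hankel matrix has entry \<open>-1\<close> where \<open>i + j + 2\<close> is a power of two and \<open>0\<close> elsewhere.
  If \<open>2 ^ k \<le> n < 2 ^ (k + 1)\<close> and \<open>m = 2 ^ (k + 1) - 1 - n\<close>, then a permutation with nonzero
  Leibniz term must reverse the interval \<open>{m..<n}\<close>: the indices \<open>i \<ge> 2 ^ k - 1\<close> admit no other
  partner, and these partners fill the rest of the interval. Hence \<open>g n = \<plusminus> g m\<close>. Since \<open>m\<close> is
  the binary complement of \<open>n\<close>, each such step removes one run of equal binary digits, so \<open>g n\<close>
  is determined by the number of runs modulo 4 and by \<open>n\<close> modulo 4, both of which a finite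
  automaton can track.
\<close>

section \<open>Automatic sequences from finite state functions\<close>

text \<open>Appending \<open>i\<close> base-\<open>k\<close> digits to \<open>n\<close> acts on the
  state \<open>u n\<close> by a map that depends only on those digits. Each kernel sequence is thus
  \<open>u\<close> followed by a map between two finite sets, and there are finitely many such
  maps.\<close>

lemma automatic_seqI:
  fixes u :: "nat \<Rightarrow> 's" and out :: "'s \<Rightarrow> 'a"
  assumes fin: "finite (range u)"
    and step: "\<And>j n. j < k \<Longrightarrow> u (k * n + j) = step j (u n)"
    and out: "\<And>n. x n = out (u n)"
  shows "automatic_seq k x"
proof -
  have fold: "\<exists>F. \<forall>n. u (k ^ i * n + j) = F (u n)" if "j < k ^ i" for i j
    using that
  proof (induction i arbitrary: j)
    case 0
    then show ?case by (intro exI[of _ id]) simp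
  next
    case (Suc i)
    have "0 < k" using Suc.prems by (cases k) auto
    moreover have "j div k < k ^ i"
      using Suc.prems by (simp add: less_mult_imp_div_less mult.commute)
    ultimately obtain F where F: "u (k ^ i * n + j div k) = F (u n)" for n
      using Suc.IH by blast
    have "u (k ^ Suc i * n + j) = step (j mod k) (F (u n))" for n
    proof -
      \<comment> \<open>The lowest digit \<open>j mod k\<close> is read last; the induction
        hypothesis handles the others.\<close>
      have "k ^ Suc i * n + j = k * (k ^ i * n + j div k) + j mod k"
        by (simp add: algebra_simps)
      then show ?thesis using step \<open>0 < k\<close> F by simp
    qed
    then show ?case by (intro exI[of _ "\<lambda>s. step (j mod k) (F s)"]) simp
  qed
  \<comment> \<open>Only the values on \<open>range u\<close> matter; restricting to it makes the
    function space finite.\<close>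
  have "kernel_seq k x \<subseteq> (\<lambda>F n. F (u n)) ` (range u \<rightarrow>\<^sub>E out ` range u)"
  proof
    fix y assume "y \<in> kernel_seq k x"
    then obtain i j where y: "y = (\<lambda>n. x (k ^ i * n + j))" and "j < k ^ i"
      unfolding kernel_seq_def by blast
    then obtain F where F: "u (k ^ i * n + j) = F (u n)" for n
      using fold by blast
    have "out (F (u n)) \<in> out ` range u" for n
      using F[of n, symmetric] by simp
    then have "restrict (out \<circ> F) (range u) \<in> range u \<rightarrow>\<^sub>E out ` range u"
      by auto
    moreover have "y = (\<lambda>n. restrict (out \<circ> F) (range u) (u n))"
      by (simp add: y out F)
    ultimately show "y \<in> (\<lambda>F n. F (u n)) ` (range u \<rightarrow>\<^sub>E out ` range u)"
      by blast
  qed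
  moreover have "finite (range u \<rightarrow>\<^sub>E out ` range u)"
    using fin by (intro finite_PiE) auto
  ultimately show ?thesis
    unfolding automatic_seq_def by (meson finite_imageI finite_subset)
qed

section \<open>Reversing an interval\<close>

definition interval_rev :: "nat \<Rightarrow> nat \<Rightarrow> nat \<Rightarrow> nat" where
  "interval_rev m n i = (if m \<le> i \<and> i < n then m + n - 1 - i else i)"

lemma interval_rev_involution [simp]: "interval_rev m n (interval_rev m n i) = i"
  by (auto simp: interval_rev_def)

lemma interval_rev_permutes: "interval_rev m n permutes {m..<n}"
proof (rule inj_imp_permutes)
  show "inj_on (interval_rev m n) {m..<n}"
    by (metis inj_onI interval_rev_involution)
qed (auto simp: interval_rev_def)

text \<open>The reversal is a product of \<open>(n - m) div 2\<close> disjoint transpositions; the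
  induction peels off the outermost one.\<close>

lemma sign_interval_rev: "sign (interval_rev m n) = (-1) ^ ((n - m) div 2)"
proof (induction "n - m" arbitrary: m n rule: less_induct)
  case less
  show ?case
  proof (cases "n - m \<le> 1")
    case True
    then have "interval_rev m n = id"
      by (auto simp: interval_rev_def fun_eq_iff)
    moreover have "(n - m) div 2 = 0"
      using True by simp
    ultimately show ?thesis by simp
  next
    case False
    then have eq: "interval_rev m n = transpose m (n - 1) \<circ> interval_rev (Suc m) (n - 1)"
      by (auto simp: interval_rev_def fun_eq_iff transpose_def)
    have "permutation (interval_rev (Suc m) (n - 1))"
      using interval_rev_permutes finite_atLeastLessThan permutation_permutes by blast
    then have "sign (interval_rev m n) = - sign (interval_rev (Suc m) (n - 1))"
      unfolding eq using False
      by (simp add: sign_compose permutation_swap_id sign_swap_id)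
    also have "\<dots> = - ((-1) ^ ((n - 1 - Suc m) div 2))"
      using less[of "n - 1" "Suc m"] False by simp
    also have "(n - m) div 2 = Suc ((n - 1 - Suc m) div 2)"
      using False by (simp add: div_if)
    then have "- ((-1) ^ ((n - 1 - Suc m) div 2)) = (-1 :: int) ^ ((n - m) div 2)"
      by simp
    finally show ?thesis .
  qed
qed

section \<open>The reflection formula\<close>

text \<open>These are the permutations whose Leibniz term in the Hankel determinant is
  nonzero.\<close>

definition pow2_perms :: "nat \<Rightarrow> (nat \<Rightarrow> nat) set" where
  "pow2_perms n = {p. p permutes {0..<n} \<and> (\<forall>i<n. \<exists>l. i + p i + 2 = 2 ^ l)}"

lemma fps_nth_one_minus_r_div_X:
  "fps_nth ((1 - r_fps) / fps_X) k = (if \<exists>l. k + 2 = 2 ^ l then - 1 else 0)"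
proof -
  have "fps_nth ((1 - r_fps) / fps_X) k = fps_nth ((1 - r_fps) / fps_X * fps_X) (Suc k)"
    by simp
  also have "\<dots> = - fps_nth r_fps (Suc k)"
    unfolding one_minus_r_div_X by simp
  also have "(\<exists>l. Suc k = 2 ^ l - 1) \<longleftrightarrow> (\<exists>l. k + 2 = 2 ^ l)"
  proof -
    have "Suc k = 2 ^ l - 1 \<longleftrightarrow> k + 2 = 2 ^ l" for l :: nat by arith
    then show ?thesis by simp
  qed
  then have "- fps_nth r_fps (Suc k) = (if \<exists>l. k + 2 = 2 ^ l then - 1 else 0)"
    unfolding nth_r_fps by simp
  finally show ?thesis .
qed

text \<open>A surviving Leibniz product has \<open>n\<close> factors, all equal to -1.\<close>

lemma g_seq_eq_sum_sign:
  "g_seq n = (-1) ^ n * (\<Sum>p \<in> pow2_perms n. of_int (sign p))"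
proof -
  let ?c = "\<lambda>k. if \<exists>l. k + 2 = 2 ^ l then - 1 else 0 :: rat"
  have "g_seq n = (\<Sum>p | p permutes {0..<n}.
      signof p * (\<Prod>i = 0..<n. ?c (i + p i)))"
    unfolding g_seq_def hankel_det_def det_def fps_nth_one_minus_r_div_X
    by (auto intro!: sum.cong prod.cong)
  also have "\<dots> = (\<Sum>p | p permutes {0..<n}.
      if p \<in> pow2_perms n then (-1) ^ n * of_int (sign p) else 0)"
  proof (rule sum.cong)
    fix p assume p: "p \<in> {p. p permutes {0..<n}}"
    show "signof p * (\<Prod>i = 0..<n. ?c (i + p i))
      = (if p \<in> pow2_perms n then (-1) ^ n * of_int (sign p) else 0)"
    proof (cases "p \<in> pow2_perms n")
      case True
      then have "(\<Prod>i = 0..<n. ?c (i + p i)) = (\<Prod>i = 0..<n. - 1)"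
        by (intro prod.cong) (auto simp: pow2_perms_def)
      then show ?thesis using True by simp
    next
      case False
      then obtain i where "i < n" "\<nexists>l. i + p i + 2 = 2 ^ l"
        using p by (auto simp: pow2_perms_def)
      then have "(\<Prod>i = 0..<n. ?c (i + p i)) = 0"
        by (intro prod_zero) auto
      then show ?thesis using False by simp
    qed
  qed simp
  also have "\<dots> = (\<Sum>p \<in> pow2_perms n. (-1) ^ n * of_int (sign p))"
    by (intro sum.mono_neutral_cong_right)
      (auto simp: pow2_perms_def finite_permutations)
  finally show ?thesis by (simp add: sum_distrib_left)
qed

lemma pow2_perms_reflect:
  assumes n: "2 ^ k \<le> n" and m: "n + m + 1 = 2 ^ Suc k"
  shows "pow2_perms n = (\<lambda>p. interval_rev m n \<circ> p) ` pow2_perms m"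
proof (rule equalityI; rule subsetI)
  let ?r = "interval_rev m n"
  have "m < n" using assms by simp
  fix p assume "p \<in> pow2_perms n"
  then have p: "p permutes {0..<n}" and pow: "\<And>i. i < n \<Longrightarrow> \<exists>l. i + p i + 2 = 2 ^ l"
    by (auto simp: pow2_perms_def)
  \<comment> \<open>The sum \<open>i + j + 2\<close> exceeds \<open>2 ^ k\<close> because one index
    is large, and is below \<open>2 ^ (k + 2)\<close> because both are less than \<open>n\<close>;
    one power of two lies in between.\<close>
  have partner: "i + j + 2 = 2 ^ Suc k"
    if pow: "\<exists>l. i + j + 2 = 2 ^ l" and large: "2 ^ k \<le> Suc i \<or> 2 ^ k \<le> Suc j"
      and less: "i < n" "j < n" for i j
  proof -
    obtain l where l: "i + j + 2 = 2 ^ l" using pow by blast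
    have "(2::nat) ^ k < 2 ^ l" unfolding l[symmetric] using large by linarith
    then have "k < l" by simp
    have "i + j + 2 < 2 * (n + m + 1)" using less by simp
    then have "(2::nat) ^ l < 2 ^ Suc (Suc k)" unfolding l m by simp
    then have "l < Suc (Suc k)"
      by (simp only: power_strict_increasing_iff one_less_numeral_iff semiring_norm)
    then have "l = Suc k" using \<open>k < l\<close> by simp
    then show ?thesis using l by simp
  qed
  have forced: "p i = ?r i" if i: "m \<le> i" "i < n" for i
  proof (cases "2 ^ k \<le> Suc i")
    case True
    have "p i < n" using permutes_in_image[OF p, of i] i by simp
    then have "i + p i + 2 = 2 ^ Suc k"
      using partner[of i "p i"] pow[of i] True i by simp
    then show ?thesis using i m by (simp add: interval_rev_def)
  next
    case False
    \<comment> \<open>The mirror image \<open>j\<close> of a small \<open>i\<close> is large, so its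
      preimage under \<open>p\<close> is forced, and it is \<open>i\<close>.\<close>
    define j where "j = m + n - 1 - i"
    have j: "j < n" "2 ^ k \<le> Suc j" "i + j + 2 = 2 ^ Suc k"
      using i m False by (auto simp: j_def)
    obtain h where h: "p h = j" "h < n"
      using permutes_image[OF p] j(1) by (metis atLeastLessThan_iff image_iff zero_le)
    have "h + j + 2 = 2 ^ Suc k"
      using partner[of h j] pow[of h] h j by simp
    then have "h = i" using j(3) by simp
    then show ?thesis using h i by (simp add: interval_rev_def j_def)
  qed
  \<comment> \<open>Undoing the forced reversal leaves a permutation that fixes everything from
    \<open>m\<close> on.\<close>
  define q where "q = ?r \<circ> p"
  have "?r permutes {0..<n}"
    using interval_rev_permutes by (rule permutes_subset) auto
  then have "q permutes {0..<n}"
    unfolding q_def using p by (intro permutes_compose)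
  moreover have "q i = i" if "i \<in> {0..<n} - {0..<m}" for i
    using forced that by (simp add: q_def)
  ultimately have q: "q permutes {0..<m}"
    by (rule permutes_superset)
  have p_eq: "p = ?r \<circ> q"
    by (simp add: q_def fun_eq_iff)
  have "\<exists>l. i + q i + 2 = 2 ^ l" if "i < m" for i
  proof -
    have "p i = q i"
      using permutes_in_image[OF q, of i] that by (simp add: p_eq interval_rev_def)
    then show ?thesis using pow[of i] that \<open>m < n\<close> by simp
  qed
  then have "q \<in> pow2_perms m" using q by (simp add: pow2_perms_def)
  then show "p \<in> (\<lambda>p. ?r \<circ> p) ` pow2_perms m" using p_eq by blast
next
  let ?r = "interval_rev m n"
  have "m < n" using assms by simp
  fix p assume "p \<in> (\<lambda>p. ?r \<circ> p) ` pow2_perms m"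
  then obtain q where p: "p = ?r \<circ> q" and q: "q permutes {0..<m}"
    and pow: "\<And>i. i < m \<Longrightarrow> \<exists>l. i + q i + 2 = 2 ^ l"
    by (auto simp: pow2_perms_def)
  have "q permutes {0..<n}"
    using q \<open>m < n\<close> by (auto intro: permutes_subset)
  moreover have "?r permutes {0..<n}"
    using interval_rev_permutes by (rule permutes_subset) auto
  ultimately have "p permutes {0..<n}"
    unfolding p by (rule permutes_compose)
  moreover have "\<exists>l. i + p i + 2 = 2 ^ l" if "i < n" for i
  proof (cases "i < m")
    case True
    then have "p i = q i"
      using permutes_in_image[OF q, of i] by (simp add: p interval_rev_def)
    then show ?thesis using pow[OF True] by simp
  next
    case False
    then have "p i = m + n - 1 - i"
      using permutes_not_in[OF q, of i] that by (simp add: p interval_rev_def)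
    then have "i + p i + 2 = 2 ^ Suc k"
      using m that False by simp
    then show ?thesis by blast
  qed
  ultimately show "p \<in> pow2_perms n"
    by (simp add: pow2_perms_def)
qed

text \<open>Here \<open>n - m = 2 * (n - 2 ^ k) + 1\<close>, so the reversal has sign
  \<open>(-1) ^ (n - 2 ^ k)\<close>. The extra factor -1 compares \<open>(-1) ^ n\<close> with
  \<open>(-1) ^ m\<close>, as \<open>n + m\<close> is odd.\<close>

lemma g_seq_reflect:
  assumes n: "2 ^ k \<le> n" and m: "n + m + 1 = 2 ^ Suc k"
  shows "g_seq n = (-1) ^ Suc (n - 2 ^ k) * g_seq m"
proof -
  let ?r = "interval_rev m n"
  have inj: "inj_on (\<lambda>p. ?r \<circ> p) (pow2_perms m)"
    by (rule inj_onI) (metis comp_apply ext interval_rev_involution)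
  have "sign (?r \<circ> p) = (-1) ^ (n - 2 ^ k) * sign p" if "p \<in> pow2_perms m" for p
  proof -
    have "permutation p"
      using that finite_atLeastLessThan permutation_permutes unfolding pow2_perms_def by blast
    moreover have "permutation ?r"
      using interval_rev_permutes finite_atLeastLessThan permutation_permutes by blast
    moreover have "(n - m) div 2 = n - 2 ^ k" using n m by simp
    ultimately show ?thesis by (simp add: sign_compose sign_interval_rev)
  qed
  then have "(\<Sum>p \<in> pow2_perms n. of_int (sign p))
      = (-1) ^ (n - 2 ^ k) * (\<Sum>p \<in> pow2_perms m. of_int (sign p) :: rat)"
    unfolding pow2_perms_reflect[OF assms] sum.reindex[OF inj]
    by (simp add: sum_distrib_left)
  moreover have "(-1 :: rat) ^ n = - ((-1) ^ m)"
  proof -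
    have "even (n + m + 1)" unfolding m by simp
    then show ?thesis by (cases "even m") auto
  qed
  ultimately show ?thesis by (simp add: g_seq_eq_sum_sign)
qed

section \<open>Runs of binary digits\<close>

text \<open>Counts digit changes after a virtual leading 0, which equals the number of runs.
  Stripping the lowest digit matches the transition from \<open>n\<close> to
  \<open>2 * n + b\<close>.\<close>

fun runs :: "nat \<Rightarrow> nat" where
  "runs n = (if n = 0 then 0
     else runs (n div 2) + (if n mod 2 = n div 2 mod 2 then 0 else 1))"

declare runs.simps [simp del]

lemma runs_0 [simp]: "runs 0 = 0"
  by (simp add: runs.simps)

lemma runs_1 [simp]: "runs (Suc 0) = 1"
  by (simp add: runs.simps)

lemma runs_double_add:
  "b < 2 \<Longrightarrow> runs (2 * n + b) = runs n + (if b = n mod 2 then 0 else 1)"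
  by (subst runs.simps) (auto simp: less_2_cases_iff)

text \<open>Starting from the virtual leading 0, every new run flips the current digit, so the
  parity of the count is the last digit.\<close>

lemma even_runs_iff: "even (runs n) \<longleftrightarrow> even n"
proof (induction n rule: less_induct)
  case (less n)
  show ?case
  proof (cases "n = 0")
    case False
    then have runs_eq: "runs n = runs (n div 2) + (if n mod 2 = n div 2 mod 2 then 0 else 1)"
      by (subst runs.simps) simp
    have "even (runs (n div 2)) \<longleftrightarrow> even (n div 2)"
      using less False by simp
    then show ?thesis
      using runs_eq by (cases "n mod 2 = n div 2 mod 2") (simp; presburger)+
  qed simp
qed

text \<open>Complementing \<open>k + 1\<close> digits keeps all changes between neighbours, but the
  leading run of ones becomes leading zeros and is lost.\<close>

lemma runs_complement:
  assumes "2 ^ k \<le> n" "n + m + 1 = 2 ^ Suc k"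
  shows "runs n = Suc (runs m)"
  using assms
proof (induction k arbitrary: n m)
  case 0
  then have "n = 1" "m = 0" by auto
  then show ?case by simp
next
  case (Suc k)
  define a b where "a = n div 2" and "b = m div 2"
  have parity: "m mod 2 = 1 - n mod 2"
    using Suc.prems(2) by simp presburger
  have ab: "n = 2 * a + n mod 2" "m = 2 * b + (1 - n mod 2)"
    unfolding a_def b_def by (simp, metis parity mult_div_mod_eq)
  then have "2 * (a + b + 1) = 2 * 2 ^ Suc k"
    using Suc.prems(2) by (simp add: mod2_eq_if split: if_splits)
  \<comment> \<open>The last digits of \<open>n\<close> and \<open>m\<close> are complementary, so
    the halves satisfy the same relation one level down.\<close>
  then have sum: "a + b + 1 = 2 ^ Suc k" by simp
  then have ab_parity: "b mod 2 = 1 - a mod 2"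
    by simp presburger
  have "2 ^ k \<le> a" using Suc.prems(1) by (simp add: a_def)
  then have "runs a = Suc (runs b)" using Suc.IH sum by blast
  moreover have "runs n = runs a + (if n mod 2 = a mod 2 then 0 else 1)"
    using runs_double_add[of "n mod 2" a] ab(1) by simp
  moreover have "runs m = runs b + (if 1 - n mod 2 = b mod 2 then 0 else 1)"
    using runs_double_add[of "1 - n mod 2" b] ab(2) by simp
  moreover have "1 - n mod 2 = b mod 2 \<longleftrightarrow> n mod 2 = a mod 2"
    unfolding ab_parity by (auto simp: mod2_eq_if)
  ultimately show ?case by simp
qed

text \<open>For \<open>k > 0\<close> reflection multiplies by \<open>(-1) ^ (n + 1)\<close>, which
  the first factor absorbs since \<open>runs n\<close> and \<open>n\<close> have equal parity. The
  second factor corrects the exceptional step from 1 to 0: the reflections starting at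
  \<open>n\<close> pass through 1 exactly when the last two digits of \<open>n\<close>
  differ.\<close>

lemma g_seq_eq_runs:
  "g_seq n = (-1) ^ (runs n div 2) * (if n mod 4 \<in> {1, 2} then - 1 else 1)"
proof (induction n rule: less_induct)
  case (less n)
  show ?case
  proof (cases "n = 0")
    case True
    then show ?thesis by (simp add: g_seq_def)
  next
    case False
    then obtain k where k: "2 ^ k \<le> n" "n < 2 ^ Suc k"
      using ex_power_ivl1[of 2 n] by auto
    define m where "m = 2 ^ Suc k - 1 - n"
    have m: "n + m + 1 = 2 ^ Suc k" using k by (simp add: m_def)
    have "m < n" using k m by simp
    note IH = less[OF this]
    have step: "g_seq n = (-1) ^ Suc (n - 2 ^ k) * g_seq m"
      using k(1) m by (rule g_seq_reflect)
    show ?thesis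
    proof (cases k)
      case 0
      then have "n = 1" "m = 0" using k m by auto
      then show ?thesis using step IH by simp
    next
      case (Suc k')
      \<comment> \<open>Modulo 4 the complement sends \<open>n\<close> to \<open>3 - n\<close>,
        which swaps 1 and 2.\<close>
      have "n + m + 1 = 4 * 2 ^ k'" using m Suc by simp
      then have "m mod 4 \<in> {1, 2} \<longleftrightarrow> n mod 4 \<in> {1, 2}" by simp presburger
      moreover have "(-1 :: rat) ^ (n - 2 ^ k) = (-1) ^ n"
        using k(1) Suc by (simp add: minus_one_power_iff)
      moreover have "(-1 :: rat) ^ (runs n div 2) = - ((-1) ^ n * (-1) ^ (runs m div 2))"
      proof -
        have "runs n = Suc (runs m)" using k(1) m by (rule runs_complement)
        moreover have "even (runs n) \<longleftrightarrow> even n" by (rule even_runs_iff)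
        ultimately show ?thesis by (cases "even n") auto
      qed
      ultimately show ?thesis using step IH by simp
    qed
  qed
qed

theorem theorem25:
  shows "automatic_seq 2 g_seq"
proof (rule automatic_seqI)
  \<comment> \<open>The run count modulo 4 fixes the parity of its half; the second component holds
    the last two digits, whose low one decides whether \<open>b\<close> opens a new run.\<close>
  let ?u = "\<lambda>n. (runs n mod 4, n mod 4)"
  let ?step = "\<lambda>b (s, t). ((s + (if b = t mod 2 then 0 else 1)) mod 4, (2 * t + b) mod 4)"
  let ?out = "\<lambda>(s, t). (-1) ^ (s div 2) * (if t \<in> {1, 2} then - 1 else 1 :: rat)"
  have "range ?u \<subseteq> {..<4} \<times> {..<4}" by auto
  then show "finite (range ?u)" by (rule finite_subset) simp
  show "?u (2 * n + b) = ?step b (?u n)" if "b < 2" for b n :: nat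
  proof -
    have "n mod 4 mod 2 = n mod 2" by (simp add: mod_mod_cancel)
    moreover have "(2 * (n mod 4) + b) mod 4 = (2 * n + b) mod 4"
      by (metis mod_add_left_eq mod_mult_right_eq)
    ultimately show ?thesis
      using that by (simp add: runs_double_add mod_add_left_eq mod_Suc_eq)
  qed
  show "g_seq n = ?out (?u n)" for n
  proof -
    have "even (runs n mod 4 div 2) \<longleftrightarrow> even (runs n div 2)" by presburger
    then show ?thesis by (simp add: g_seq_eq_runs minus_one_power_iff)
  qed
qed

end
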